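(* Consider the initial value problem $u'(t)=Au(t)+g(t)$, $u(0)=u_0$, and a sequence of basis functions $[\phi_i]_{i=0}^\infty$ satisfying $$\frac{d}{dt}\begin{bmatrix}\phi_0(t)\\\phi_1(t)\\\vdots\end{bmatrix}=H_\infty\begin{bmatrix}\phi_0(t)\\\phi_1(t)\\\vdots\end{bmatrix},\qquad\begin{bmatrix}\phi_0(0)\\\phi_1(0)\\\vdots\end{bmatrix}=e_1,$$ where $H_\infty\in\mathbb{R}^{\infty\times\infty}$ is an infinite-dimensional Hessenberg matrix such that, for a fixed constant $C\ge 0$, $\|H_N\|<C$ for all $N=0,\dots,\infty$, $H_N\in\mathbb{R}^{N\times N}$ being the leading submatrix of $H_\infty$. Suppose that $g$ can be expanded as $g(s)=\sum_{\ell=0}^\infty w_\ell\phi_\ell(s)$ with $w_\ell\in\mathbb{C}^n$, and let $W_\infty=[w_0,w_1,w_2,\dots]\in\mathbb{C}^{n\times\infty}$. (a) Suppose $u(t)$ is a solution to $u'(t)=Au(t)+g(t)$, $u(0)=u_0$. Then $$\frac{d}{dt}\begin{bmatrix}u\\\phi_0\\\vdots\end{bmatrix}=\begin{bmatrix}A&W_\infty\\0&H_\infty\end{bmatrix}\begin{bmatrix}u\\\phi_0\\\vdots\end{bmatrix},\qquad\begin{bmatrix}u(0)\\\phi_0(0)\\\vdots\end{bmatrix}=\begin{bmatrix}u_0\\ e_1\end{bmatrix}.$$ (b) Suppose $v(t)$ satisfies $$v'(t)=\begin{bmatrix}A&W_\infty\\0&H_\infty\end{bmatrix}v(t),\qquad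 v(0)=\begin{bmatrix}u_0\\ e_1\end{bmatrix}.$$ Then the function $u(t):=\begin{bmatrix}I_n&0\end{bmatrix}v(t)$ is the unique solution to $u'(t)=Au(t)+g(t)$, $u(0)=u_0$.
   Context: $A\in\mathbb{C}^{n\times n}$, $u_0\in\mathbb{C}^n$, $g:\mathbb{C}\to\mathbb{C}^n$ has entire components. $\|\cdot\|$ is the Euclidean/spectral norm; for $N=\infty$ it is the operator norm on $\ell^2$. "Hessenberg" means upper Hessenberg: entries below the first subdiagonal vanish. $e_1$ is the first unit vector. Infinite vectors are sequences; the ODE for the components governed by $H_\infty$ is understood as an ODE in $\ell^2$ with the bounded operator $H_\infty$, and $W_\infty x$ denotes the series $\sum_{\ell\ge0}w_\ell x_\ell$. $[I_n\ 0]v$ denotes the first $n$ components of $v$. *)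

theory Defs
  imports "HOL-Analysis.Analysis"
begin

section \<open>The Hilbert space of square-summable complex sequences\<close>

lemma summable_sq_add:
  fixes x y :: "nat \<Rightarrow> complex"
  assumes "summable (\<lambda>k. (cmod (x k))\<^sup>2)" "summable (\<lambda>k. (cmod (y k))\<^sup>2)"
  shows "summable (\<lambda>k. (cmod (x k + y k))\<^sup>2)"
proof (rule summable_comparison_test')
  show "summable (\<lambda>k. 2 * (cmod (x k))\<^sup>2 + 2 * (cmod (y k))\<^sup>2)"
    using assms by (intro summable_add summable_mult)
next
  fix k :: nat
  have "(cmod (x k + y k))\<^sup>2 \<le> (cmod (x k) + cmod (y k))\<^sup>2"
    by (intro power_mono norm_triangle_ineq) auto
  also have "\<dots> \<le> 2 * (cmod (x k))\<^sup>2 + 2 * (cmod (y k))\<^sup>2"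
    using sum_squares_bound[of "cmod (x k)" "cmod (y k)"]
    by (simp add: power2_sum)
  finally show "norm ((cmod (x k + y k))\<^sup>2) \<le> 2 * (cmod (x k))\<^sup>2 + 2 * (cmod (y k))\<^sup>2"
    by simp
qed

lemma summable_sq_mult:
  fixes x :: "nat \<Rightarrow> complex"
  assumes "summable (\<lambda>k. (cmod (x k))\<^sup>2)"
  shows "summable (\<lambda>k. (cmod (c * x k))\<^sup>2)"
  using summable_mult[OF assms, of "(cmod c)\<^sup>2"]
  by (simp add: norm_mult power_mult_distrib)

typedef ell2 = "{x :: nat \<Rightarrow> complex. summable (\<lambda>k. (cmod (x k))\<^sup>2)}"
  morphisms ell2_nth Abs_ell2
  by (rule exI[of _ "\<lambda>_. 0"]) simp

setup_lifting type_definition_ell2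

lemma ell2_eqI: "(\<And>k. ell2_nth x k = ell2_nth y k) \<Longrightarrow> x = y"
  by (simp add: ell2_nth_inject[symmetric] fun_eq_iff)

lemma ell2_summable: "summable (\<lambda>k. (cmod (ell2_nth x k))\<^sup>2)"
  using ell2_nth[of x] by simp

lemma ell2_summable_inner: "summable (\<lambda>k. ell2_nth x k \<bullet> ell2_nth y k)"
proof (rule summable_comparison_test')
  show "summable (\<lambda>k. (cmod (ell2_nth x k))\<^sup>2 + (cmod (ell2_nth y k))\<^sup>2)"
    by (intro summable_add ell2_summable)
next
  fix k :: nat
  have "\<bar>ell2_nth x k \<bullet> ell2_nth y k\<bar> \<le> cmod (ell2_nth x k) * cmod (ell2_nth y k)"
    by (rule Cauchy_Schwarz_ineq2)
  also have "\<dots> \<le> 2 * cmod (ell2_nth x k) * cmod (ell2_nth y k)"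
    by simp
  also have "\<dots> \<le> (cmod (ell2_nth x k))\<^sup>2 + (cmod (ell2_nth y k))\<^sup>2"
    by (rule sum_squares_bound)
  finally show "norm (ell2_nth x k \<bullet> ell2_nth y k)
      \<le> (cmod (ell2_nth x k))\<^sup>2 + (cmod (ell2_nth y k))\<^sup>2"
    by simp
qed

instantiation ell2 :: real_inner
begin

lift_definition zero_ell2 :: ell2 is "\<lambda>_. 0" by simp

lift_definition plus_ell2 :: "ell2 \<Rightarrow> ell2 \<Rightarrow> ell2" is "\<lambda>x y k. x k + y k"
  by (rule summable_sq_add)

lift_definition uminus_ell2 :: "ell2 \<Rightarrow> ell2" is "\<lambda>x k. - x k" by simp

lift_definition minus_ell2 :: "ell2 \<Rightarrow> ell2 \<Rightarrow> ell2" is "\<lambda>x y k. x k - y k"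
  subgoal for x y using summable_sq_add[of x "\<lambda>k. - y k"] by simp
  done

lift_definition scaleR_ell2 :: "real \<Rightarrow> ell2 \<Rightarrow> ell2" is "\<lambda>r x k. r *\<^sub>R x k"
  by (simp add: scaleR_conv_of_real summable_sq_mult del: norm_mult)

definition inner_ell2 :: "ell2 \<Rightarrow> ell2 \<Rightarrow> real"
  where "inner_ell2 x y = (\<Sum>k. ell2_nth x k \<bullet> ell2_nth y k)"

definition norm_ell2 :: "ell2 \<Rightarrow> real"
  where "norm_ell2 x = sqrt (\<Sum>k. (cmod (ell2_nth x k))\<^sup>2)"

definition dist_ell2 :: "ell2 \<Rightarrow> ell2 \<Rightarrow> real"
  where "dist_ell2 x y = norm (x - y)"

definition sgn_ell2 :: "ell2 \<Rightarrow> ell2"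
  where "sgn_ell2 x = inverse (norm x) *\<^sub>R x"

definition uniformity_ell2 :: "(ell2 \<times> ell2) filter"
  where "uniformity_ell2 = (INF e\<in>{0<..}. principal {(x, y). dist x y < e})"

definition open_ell2 :: "ell2 set \<Rightarrow> bool"
  where "open_ell2 U \<longleftrightarrow> (\<forall>x\<in>U. \<forall>\<^sub>F (x', y) in uniformity. x' = x \<longrightarrow> y \<in> U)"

instance
proof
  fix x y z :: ell2 and a b :: real
  show "x + y + z = x + (y + z)" "x + y = y + x" "0 + x = x" "- x + x = 0" "x - y = x + - y"
    by (transfer; simp add: fun_eq_iff)+
  show "a *\<^sub>R (x + y) = a *\<^sub>R x + a *\<^sub>R y" "(a + b) *\<^sub>R x = a *\<^sub>R x + b *\<^sub>R x"
    "a *\<^sub>R b *\<^sub>R x = (a * b) *\<^sub>R x" "1 *\<^sub>R x = x"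
    by (transfer; simp add: fun_eq_iff scaleR_add_right scaleR_add_left)+
  show "dist x y = norm (x - y)" by (rule dist_ell2_def)
  show "sgn x = inverse (norm x) *\<^sub>R x" by (rule sgn_ell2_def)
  show "uniformity = (INF e\<in>{0<..}. principal {(x :: ell2, y). dist x y < e})"
    by (rule uniformity_ell2_def)
  show "open U \<longleftrightarrow> (\<forall>x\<in>U. \<forall>\<^sub>F (x', y) in uniformity. x' = x \<longrightarrow> y \<in> U)" for U :: "ell2 set"
    by (rule open_ell2_def)
  show "x \<bullet> y = y \<bullet> x"
    by (simp add: inner_ell2_def inner_commute)
  show "(x + y) \<bullet> z = x \<bullet> z + y \<bullet> z"
    unfolding inner_ell2_def plus_ell2.rep_eq inner_add_left
    by (rule suminf_add[symmetric]) (rule ell2_summable_inner)+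
  show "(a *\<^sub>R x) \<bullet> y = a * (x \<bullet> y)"
    unfolding inner_ell2_def scaleR_ell2.rep_eq inner_scaleR_left
    by (rule suminf_mult) (rule ell2_summable_inner)
  show "0 \<le> x \<bullet> x"
    unfolding inner_ell2_def by (intro suminf_nonneg ell2_summable_inner) simp
  show "x \<bullet> x = 0 \<longleftrightarrow> x = 0"
  proof
    assume "x \<bullet> x = 0"
    then have "\<forall>k. ell2_nth x k \<bullet> ell2_nth x k = 0"
      unfolding inner_ell2_def
      by (subst (asm) suminf_eq_zero_iff) (auto intro: ell2_summable_inner)
    then show "x = 0"
      by (intro ell2_eqI) (simp add: zero_ell2.rep_eq)
  next
    assume "x = 0"
    then show "x \<bullet> x = 0" by (simp add: inner_ell2_def zero_ell2.rep_eq)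
  qed
  show "norm x = sqrt (x \<bullet> x)"
    by (simp add: norm_ell2_def inner_ell2_def power2_norm_eq_inner)
qed

end

lift_definition ell2_scaleC :: "complex \<Rightarrow> ell2 \<Rightarrow> ell2" is "\<lambda>c x k. c * x k"
  by (rule summable_sq_mult)

lift_definition ell2_e1 :: ell2 is "\<lambda>k. if k = 0 then 1 else 0"
proof -
  show "summable (\<lambda>k :: nat. (cmod (if k = 0 then 1 else 0))\<^sup>2)"
    by (rule summable_finite[of "{0}"]) auto
qed


section \<open>Infinite matrices\<close>

text \<open>Rows and columns are numbered from 0.\<close>

definition upper_hessenberg :: "(nat \<Rightarrow> nat \<Rightarrow> real) \<Rightarrow> bool"
  where "upper_hessenberg H \<longleftrightarrow> (\<forall>i j. i > j + 1 \<longrightarrow> H i j = 0)"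

text \<open>Spectral norm of the leading \<open>N \<times> N\<close> submatrix. The form follows \<^const>\<open>onorm\<close>; by
  \<open>0 / 0 = 0\<close> the vectors whose first \<open>N\<close> entries vanish contribute \<open>0\<close>, and the empty
  matrix has norm \<open>0\<close>.\<close>

definition leading_norm :: "(nat \<Rightarrow> nat \<Rightarrow> real) \<Rightarrow> nat \<Rightarrow> real"
  where "leading_norm H N =
    (SUP x :: nat \<Rightarrow> complex.
       L2_set (\<lambda>i. cmod (\<Sum>j<N. of_real (H i j) * x j)) {..<N} / L2_set (\<lambda>j. cmod (x j)) {..<N})"

definition ell2_op :: "(nat \<Rightarrow> nat \<Rightarrow> real) \<Rightarrow> ell2 \<Rightarrow> ell2"
  where "ell2_op H x = Abs_ell2 (\<lambda>i. \<Sum>j. of_real (H i j) * ell2_nth x j)"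

text \<open>The first two conjuncts say that the matrix-vector product converges and lies in the space,
  so that \<^const>\<open>ell2_op\<close> is meaningful.\<close>

definition ell2_bounded :: "(nat \<Rightarrow> nat \<Rightarrow> real) \<Rightarrow> bool"
  where "ell2_bounded H \<longleftrightarrow>
    (\<forall>x i. summable (\<lambda>j. of_real (H i j) * ell2_nth x j)) \<and>
    (\<forall>x. summable (\<lambda>i. (cmod (\<Sum>j. of_real (H i j) * ell2_nth x j))\<^sup>2)) \<and>
    bounded_linear (ell2_op H)"


section \<open>The initial value problems\<close>

text \<open>The time domain \<open>D\<close> is a set of complex numbers; \<open>h \<mapsto> h \<cdot> y\<close> as derivative within \<open>D\<close> is the
  complex derivative if \<open>D\<close> is open, and the ordinary derivative with respect to real time if \<open>D\<close> is a
  real interval.\<close>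

definition solves_ivp ::
    "complex set \<Rightarrow> complex^'n^'n \<Rightarrow> (complex \<Rightarrow> complex^'n) \<Rightarrow> complex^'n \<Rightarrow> (complex \<Rightarrow> complex^'n) \<Rightarrow> bool"
  where "solves_ivp D A g u0 u \<longleftrightarrow>
    (\<forall>t\<in>D. (u has_derivative (\<lambda>h. h *s (A *v u t + g t))) (at t within D)) \<and> u 0 = u0"

definition solves_basis_ivp :: "complex set \<Rightarrow> (nat \<Rightarrow> nat \<Rightarrow> real) \<Rightarrow> (complex \<Rightarrow> ell2) \<Rightarrow> bool"
  where "solves_basis_ivp D H \<phi> \<longleftrightarrow>
    (\<forall>t\<in>D. (\<phi> has_derivative (\<lambda>h. ell2_scaleC h (ell2_op H (\<phi> t)))) (at t within D)) \<and> \<phi> 0 = ell2_e1"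

text \<open>The columns \<open>w l\<close> need not be square-summable, so the series \<open>W x\<close> may diverge for some \<open>x\<close>;
  its convergence along the solution is part of the block equation.\<close>

definition block_op ::
    "complex^'n^'n \<Rightarrow> (nat \<Rightarrow> complex^'n) \<Rightarrow> (nat \<Rightarrow> nat \<Rightarrow> real) \<Rightarrow> (complex^'n) \<times> ell2 \<Rightarrow> (complex^'n) \<times> ell2"
  where "block_op A w H = (\<lambda>(x, y). (A *v x + (\<Sum>l. ell2_nth y l *s w l), ell2_op H y))"

definition solves_block_ivp ::
    "complex set \<Rightarrow> complex^'n^'n \<Rightarrow> (nat \<Rightarrow> complex^'n) \<Rightarrow> (nat \<Rightarrow> nat \<Rightarrow> real) \<Rightarrow> complex^'n
      \<Rightarrow> (complex \<Rightarrow> (complex^'n) \<times> ell2) \<Rightarrow> bool"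
  where "solves_block_ivp D A w H u0 v \<longleftrightarrow>
    (\<forall>t\<in>D. summable (\<lambda>l. ell2_nth (snd (v t)) l *s w l) \<and>
      (v has_derivative (\<lambda>h. map_prod ((*s) h) (ell2_scaleC h) (block_op A w H (v t)))) (at t within D)) \<and>
    v 0 = (u0, ell2_e1)"

end

theory Submission imports Defs begin

text \<open>Both block rows of the augmented system are linear complex initial value problems, and the two
  formulations differ only in how the inhomogeneity is written: once the \<open>\<phi>\<close>-components are known,
  \<open>W \<phi>(t)\<close> is \<open>g(t)\<close>. So (a) is a componentwise reading of the derivative of a pair.

  For (b), the second block row is decoupled from the first one, and the second component of \<open>v\<close> and
  \<open>\<phi>\<close> solve it with the same initial value. Since the operator is bounded on \<open>\<ell>\<^sup>2\<close>, they agree on \<open>D\<close>,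
  which turns the first block row into \<open>u' = A u + g\<close>. Uniqueness of \<open>u\<close> is the same fact with the
  bounded operator \<open>A\<close>. Both uses are covered by the lemma \<open>affine_ivp_unique\<close>: every point of the
  convex time domain is joined to \<open>0\<close> by a segment inside the domain, and along this segment a
  Gronwall estimate for the squared norm of the difference of two solutions applies.\<close>

text \<open>The hypothesis makes \<open>\<parallel>f\<parallel>\<^sup>2\<close> grow at rate at most \<open>2 L\<close>, so \<open>e\<^bsup>-2 L s\<^esup> \<parallel>f s\<parallel>\<^sup>2\<close> is a nonnegative
  nonincreasing function that starts at \<open>0\<close>.\<close>

lemma gronwall_zero:
  fixes f :: "real \<Rightarrow> 'a::real_inner"
  assumes deriv: "\<And>s. s \<in> {0..1} \<Longrightarrow> (f has_vector_derivative f' s) (at s within {0..1})"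
    and bound: "\<And>s. s \<in> {0..1} \<Longrightarrow> norm (f' s) \<le> L * norm (f s)"
    and "f 0 = 0"
  shows "f 1 = 0"
proof -
  define \<psi> where "\<psi> s = exp (- 2 * L * s) * (f s \<bullet> f s)" for s
  define \<psi>' where "\<psi>' s = exp (- 2 * L * s) * (2 * (f s \<bullet> f' s) - 2 * L * (f s \<bullet> f s))" for s
  have D\<psi>: "(\<psi> has_real_derivative \<psi>' s) (at s within {0..1})" if "s \<in> {0..1}" for s
  proof -
    have "((\<lambda>s. f s \<bullet> f s) has_real_derivative 2 * (f s \<bullet> f' s)) (at s within {0..1})"
      using bounded_bilinear.has_vector_derivative[OF bounded_bilinear_inner deriv[OF that] deriv[OF that]]
      by (simp add: has_real_derivative_iff_has_vector_derivative inner_commute)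
    from DERIV_mult[OF _ this, of "\<lambda>s. exp (- 2 * L * s)" "- 2 * L * exp (- 2 * L * s)"]
    show ?thesis
      unfolding \<psi>_def \<psi>'_def
      by (rule DERIV_cong) (auto intro!: derivative_eq_intros simp: algebra_simps)
  qed
  have nonpos: "\<psi>' s \<le> 0" if "s \<in> {0..1}" for s
  proof -
    have "f s \<bullet> f' s \<le> norm (f s) * norm (f' s)"
      by (rule norm_cauchy_schwarz)
    also have "\<dots> \<le> norm (f s) * (L * norm (f s))"
      by (intro mult_left_mono bound that) simp
    also have "\<dots> = L * (f s \<bullet> f s)"
      by (simp add: power2_norm_eq_inner[symmetric] power2_eq_square)
    finally show ?thesis
      by (simp add: \<psi>'_def mult_le_0_iff)
  qed
  have "\<psi> 1 \<le> \<psi> 0"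
  proof (rule DERIV_nonpos_imp_decreasing_open[of 0 1 \<psi>])
    show "\<exists>y. (\<psi> has_real_derivative y) (at s) \<and> y \<le> 0" if "0 < s" "s < 1" for s
      using D\<psi>[of s] nonpos[of s] that at_within_Icc_at[of 0 s 1] by auto
    show "continuous_on {0..1} \<psi>"
      using D\<psi> by (intro DERIV_continuous_on)
  qed simp
  then have "f 1 \<bullet> f 1 \<le> 0"
    using \<open>f 0 = 0\<close> by (simp add: \<psi>_def mult_le_0_iff)
  then show ?thesis
    by (metis inner_eq_zero_iff inner_ge_zero order_antisym)
qed

text \<open>The bilinear map \<open>scl\<close> stands for multiplication by complex scalars, so that one statement covers
  \<open>\<complex>\<^sup>n\<close> and \<open>\<ell>\<^sup>2\<close>, which carry only a real vector space structure as types.\<close>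

lemma affine_ivp_unique:
  fixes scl :: "complex \<Rightarrow> 'a::real_inner \<Rightarrow> 'a" and x y :: "complex \<Rightarrow> 'a"
  assumes "bounded_bilinear scl" and "bounded_linear T" and "convex D" and "0 \<in> D"
    and x: "\<And>t. t \<in> D \<Longrightarrow> (x has_derivative (\<lambda>h. scl h (T (x t) + b t))) (at t within D)"
    and y: "\<And>t. t \<in> D \<Longrightarrow> (y has_derivative (\<lambda>h. scl h (T (y t) + b t))) (at t within D)"
    and "x 0 = y 0" and "t \<in> D"
  shows "x t = y t"
proof -
  interpret scl: bounded_bilinear scl by fact
  interpret T: bounded_linear T by fact
  define d where "d t = x t - y t" for t
  have d: "(d has_derivative (\<lambda>h. scl h (T (d t)))) (at t within D)" if "t \<in> D" for t
    using has_derivative_diff[OF x[OF that] y[OF that]]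
    by (simp add: d_def[abs_def] scl.diff_right[symmetric] T.diff)
  define \<gamma> where "\<gamma> s = s *\<^sub>R t" for s :: real
  have \<gamma>_in: "\<gamma> s \<in> D" if "s \<in> {0..1}" for s
    using convexD_alt[OF \<open>convex D\<close> \<open>0 \<in> D\<close> \<open>t \<in> D\<close>, of s] that by (simp add: \<gamma>_def)
  obtain K where K: "\<And>c z. norm (scl c z) \<le> norm c * norm z * K" "0 \<le> K"
    using scl.nonneg_bounded by blast
  obtain M where M: "\<And>z. norm (T z) \<le> norm z * M"
    using T.bounded by blast
  have "(d \<circ> \<gamma>) 1 = 0"
  proof (rule gronwall_zero)
    fix s :: real assume s: "s \<in> {0..1}"
    have "(\<gamma> has_derivative (\<lambda>r. r *\<^sub>R t)) (at s within {0..1})"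
      unfolding \<gamma>_def by (auto intro!: derivative_eq_intros)
    moreover have "(d has_derivative (\<lambda>h. scl h (T (d (\<gamma> s))))) (at (\<gamma> s) within \<gamma> ` {0..1})"
      using \<gamma>_in by (intro has_derivative_subset[OF d[OF \<gamma>_in[OF s]]]) auto
    ultimately have "(d \<circ> \<gamma> has_derivative (\<lambda>h. scl h (T (d (\<gamma> s)))) \<circ> (\<lambda>r. r *\<^sub>R t))
        (at s within {0..1})"
      by (rule diff_chain_within)
    then show "(d \<circ> \<gamma> has_vector_derivative scl t (T ((d \<circ> \<gamma>) s))) (at s within {0..1})"
      by (simp add: has_vector_derivative_def o_def scl.scaleR_left)
    have "norm (scl t (T (d (\<gamma> s)))) \<le> norm t * norm (T (d (\<gamma> s))) * K"
      by (rule K)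
    also have "\<dots> \<le> norm t * (norm (d (\<gamma> s)) * M) * K"
      by (intro mult_right_mono mult_left_mono M K) simp
    finally show "norm (scl t (T ((d \<circ> \<gamma>) s))) \<le> (norm t * M * K) * norm ((d \<circ> \<gamma>) s)"
      by (simp add: algebra_simps)
  next
    show "(d \<circ> \<gamma>) 0 = 0"
      using \<open>x 0 = y 0\<close> by (simp add: d_def \<gamma>_def)
  qed
  then show ?thesis
    by (simp add: d_def \<gamma>_def)
qed

lemma norm_ell2_scaleC: "norm (ell2_scaleC c x) = cmod c * norm x"
  using ell2_summable[of x]
  by (simp add: norm_ell2_def ell2_scaleC.rep_eq norm_mult power_mult_distrib suminf_mult
      real_sqrt_mult)

lemma bounded_bilinear_ell2_scaleC: "bounded_bilinear ell2_scaleC"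
proof
  show "\<exists>K. \<forall>c x. norm (ell2_scaleC c x) \<le> norm c * norm x * K"
    by (rule exI[of _ 1]) (simp add: norm_ell2_scaleC)
qed (transfer; simp add: fun_eq_iff algebra_simps scaleR_conv_of_real)+

lemma norm_vector_scalar_mult:
  fixes x :: "complex^'n"
  shows "norm (c *s x) = cmod c * norm x"
  by (simp add: norm_vec_def vector_scalar_mult_def norm_mult L2_set_right_distrib)

lemma bounded_bilinear_vector_scalar_mult:
  "bounded_bilinear ((*s) :: complex \<Rightarrow> complex^'n \<Rightarrow> complex^'n)"
proof
  show "\<exists>K. \<forall>c (x :: complex^'n). norm (c *s x) \<le> norm c * norm x * K"
    by (rule exI[of _ 1]) (simp add: norm_vector_scalar_mult)
qed (simp_all add: vec_eq_iff algebra_simps scaleR_conv_of_real[where 'a=complex])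

lemma bounded_linear_matrix_vector_mult_complex:
  "bounded_linear ((*v) (A :: complex^'n^'m))"
  unfolding linear_conv_bounded_linear[symmetric]
  by (rule linearI)
    (simp_all add: vec_eq_iff matrix_vector_mult_def algebra_simps sum.distrib
      scaleR_conv_of_real[where 'a=complex] sum_distrib_left)

theorem lemma1:
  fixes D :: "complex set"
    and A :: "complex^'n^'n" and u0 :: "complex^'n" and g :: "complex \<Rightarrow> complex^'n"
    and H :: "nat \<Rightarrow> nat \<Rightarrow> real" and C :: real
    and \<phi> :: "complex \<Rightarrow> ell2" and w :: "nat \<Rightarrow> complex^'n"
  assumes "convex D" and "0 \<in> D"
    and "\<And>i. (\<lambda>s. g s $ i) holomorphic_on UNIV"
    and "upper_hessenberg H"
    and "0 \<le> C" and "\<And>N. leading_norm H N < C"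
    and "ell2_bounded H" and "onorm (ell2_op H) < C"
    and "solves_basis_ivp D H \<phi>"
    and "\<And>s. s \<in> D \<Longrightarrow> (\<lambda>l. ell2_nth (\<phi> s) l *s w l) sums g s"
  shows "(\<forall>u. solves_ivp D A g u0 u \<longrightarrow> solves_block_ivp D A w H u0 (\<lambda>t. (u t, \<phi> t))) \<and>
    (\<forall>v. solves_block_ivp D A w H u0 v \<longrightarrow>
      solves_ivp D A g u0 (\<lambda>t. fst (v t)) \<and>
      (\<forall>y. solves_ivp D A g u0 y \<longrightarrow> (\<forall>t\<in>D. y t = fst (v t))))"
proof (intro conjI allI impI ballI)
  have series: "summable (\<lambda>l. ell2_nth (\<phi> t) l *s w l)" "(\<Sum>l. ell2_nth (\<phi> t) l *s w l) = g t"
    if "t \<in> D" for t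
    using assms(10)[OF that] by (auto simp: sums_iff)
  have \<phi>: "(\<phi> has_derivative (\<lambda>h. ell2_scaleC h (ell2_op H (\<phi> t)))) (at t within D)"
    if "t \<in> D" for t
    using assms(9) that by (simp add: solves_basis_ivp_def)
  have \<phi>0: "\<phi> 0 = ell2_e1"
    using assms(9) by (simp add: solves_basis_ivp_def)
  have H: "bounded_linear (ell2_op H)"
    using assms(7) by (simp add: ell2_bounded_def)
  {
    fix u assume u: "solves_ivp D A g u0 u"
    have "((\<lambda>t. (u t, \<phi> t)) has_derivative
        (\<lambda>h. (h *s (A *v u t + g t), ell2_scaleC h (ell2_op H (\<phi> t))))) (at t within D)"
      if "t \<in> D" for t
      using u \<phi> that by (intro has_derivative_Pair) (auto simp: solves_ivp_def)
    then show "solves_block_ivp D A w H u0 (\<lambda>t. (u t, \<phi> t))"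
      using u \<phi>0 series by (auto simp: solves_block_ivp_def solves_ivp_def block_op_def)
  }
  fix v assume v: "solves_block_ivp D A w H u0 v"
  have dv: "((\<lambda>t. fst (v t)) has_derivative
        (\<lambda>h. h *s (A *v fst (v t) + (\<Sum>l. ell2_nth (snd (v t)) l *s w l)))) (at t within D)"
      "((\<lambda>t. snd (v t)) has_derivative (\<lambda>h. ell2_scaleC h (ell2_op H (snd (v t))))) (at t within D)"
    if "t \<in> D" for t
  proof -
    have "(v has_derivative (\<lambda>h. map_prod ((*s) h) (ell2_scaleC h) (block_op A w H (v t))))
        (at t within D)"
      using v that by (simp add: solves_block_ivp_def)
    from has_derivative_fst[OF this] has_derivative_snd[OF this] show
      "((\<lambda>t. fst (v t)) has_derivative
        (\<lambda>h. h *s (A *v fst (v t) + (\<Sum>l. ell2_nth (snd (v t)) l *s w l)))) (at t within D)"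
      "((\<lambda>t. snd (v t)) has_derivative (\<lambda>h. ell2_scaleC h (ell2_op H (snd (v t))))) (at t within D)"
      by (simp_all add: block_op_def case_prod_beta)
  qed
  have v0: "v 0 = (u0, ell2_e1)"
    using v by (simp add: solves_block_ivp_def)
  have snd_v: "snd (v t) = \<phi> t" if "t \<in> D" for t
    by (rule affine_ivp_unique[OF bounded_bilinear_ell2_scaleC H \<open>convex D\<close> \<open>0 \<in> D\<close>,
          where b = "\<lambda>_. 0"])
      (simp_all add: dv \<phi> \<phi>0 v0 that)
  show fst_v: "solves_ivp D A g u0 (\<lambda>t. fst (v t))"
    unfolding solves_ivp_def using dv(1) v0 by (simp add: snd_v series)
  fix y t assume y: "solves_ivp D A g u0 y" and "t \<in> D"
  have ivp: "(z has_derivative (\<lambda>h. h *s (A *v z s + g s))) (at s within D)" "z 0 = u0"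
    if "solves_ivp D A g u0 z" "s \<in> D" for z s
    using that unfolding solves_ivp_def by blast+
  show "y t = fst (v t)"
    by (rule affine_ivp_unique[OF bounded_bilinear_vector_scalar_mult
          bounded_linear_matrix_vector_mult_complex \<open>convex D\<close> \<open>0 \<in> D\<close> ivp(1)[OF y]
          ivp(1)[OF fst_v]])
      (simp_all add: \<open>t \<in> D\<close> ivp(2)[OF y \<open>0 \<in> D\<close>] v0)
qed

end
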